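(* Let $G$ be a graph and $\mathcal{H}$ a set of graphs, and suppose $G$ is critically $\mathcal{H}$-exist. Then for every $S\subseteq V(G)$ such that $G[S]$ is isomorphic to a graph in $\mathcal{H}$: (1) $V(G)\setminus S$ is an independent set, and (2) no vertex $x\in V(G)\setminus S$ satisfies $N[x]\subseteq N[y]$ for some $y\in S$.
   Context: All graphs are finite and simple; $N[x]=N(x)\cup\{x\}$ is the closed neighbourhood and $G[S]$ the induced subgraph. A graph is $\mathcal{H}$-free if none of its induced subgraphs is isomorphic to a graph in $\mathcal{H}$, and $\mathcal{H}$-exist otherwise. For an edge $e=uv$, the contraction $G/e$ is obtained by deleting $u,v$ and adding a new vertex adjacent to every vertex of $(N(u)\cup N(v))\setminus\{u,v\}$. $G$ is critically $\mathcal{H}$-exist if it is $\mathcal{H}$-exist and $G/e$ is $\mathcal{H}$-free for every $e\in E(G)$. *)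

theory Defs
  imports "Graph_Theory.Pair_Digraph" "Graph_Theory.Digraph_Isomorphism"
begin

text \<open>
  A finite simple graph is a \<^locale>\<open>pair_graph\<close>: a finite, loop-free, symmetric digraph whose
  arcs are ordered pairs of vertices, so the edge \<open>uv\<close> is the pair of arcs \<open>(u, v)\<close>, \<open>(v, u)\<close>.
\<close>

definition neighbourhood :: "'a pair_pre_digraph \<Rightarrow> 'a \<Rightarrow> 'a set" where
  "neighbourhood G x = {y. (x, y) \<in> parcs G}"

definition closed_neighbourhood :: "'a pair_pre_digraph \<Rightarrow> 'a \<Rightarrow> 'a set" where
  "closed_neighbourhood G x = insert x (neighbourhood G x)"

definition independent_set :: "'a pair_pre_digraph \<Rightarrow> 'a set \<Rightarrow> bool" where
  "independent_set G I \<longleftrightarrow> I \<subseteq> pverts G \<and> (\<forall>x\<in>I. \<forall>y\<in>I. (x, y) \<notin> parcs G)"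

text \<open>\<^const>\<open>None\<close> is the vertex created by the contraction.\<close>

definition contract :: "'a pair_pre_digraph \<Rightarrow> 'a \<Rightarrow> 'a \<Rightarrow> 'a option pair_pre_digraph" where
  "contract G u v =
    (let W = (neighbourhood G u \<union> neighbourhood G v) - {u, v}
     in \<lparr> pverts = insert None (Some ` (pverts G - {u, v})),
          parcs = {(Some x, Some y) | x y. (x, y) \<in> parcs G \<and> x \<notin> {u, v} \<and> y \<notin> {u, v}}
            \<union> {(None, Some w) | w. w \<in> W} \<union> {(Some w, None) | w. w \<in> W} \<rparr>)"

lemma pair_graph_contract:
  assumes "pair_graph G"
  shows "pair_graph (contract G u v)"
proof -
  interpret pair_graph G by fact
  let ?C = "contract G u v"
  have V: "finite (pverts ?C)"
    by (simp add: contract_def Let_def pair_finite_verts)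
  have A: "parcs ?C \<subseteq> pverts ?C \<times> pverts ?C"
    by (auto simp: contract_def Let_def neighbourhood_def dest: in_arcsD1 in_arcsD2)
  then have "finite (parcs ?C)"
    using V by (meson finite_SigmaI finite_subset)
  moreover have "\<And>e. e \<in> parcs ?C \<Longrightarrow> fst e \<noteq> snd e"
    by (auto simp: contract_def Let_def dest: no_loops')
  moreover have "symmetric (with_proj ?C)"
    by (auto simp: symmetric_def contract_def Let_def intro!: symI dest: arcs_symmetric)
  ultimately show ?thesis
    using V A by unfold_locales auto
qed

text \<open>
  The members of \<open>\<H>\<close> may live on a different vertex type than \<open>G\<close>; only their isomorphism
  types matter, and the same \<open>\<H>\<close> is compared both with \<open>G\<close> and with its contractions.
\<close>

definition free_of :: "'b pair_pre_digraph set \<Rightarrow> 'a pair_pre_digraph \<Rightarrow> bool" where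
  "free_of \<H> G \<longleftrightarrow>
    (\<forall>K. induced_subgraph K (with_proj G) \<longrightarrow> \<not> (\<exists>H\<in>\<H>. digraph_iso K (with_proj H)))"

definition exist_of :: "'b pair_pre_digraph set \<Rightarrow> 'a pair_pre_digraph \<Rightarrow> bool" where
  "exist_of \<H> G \<longleftrightarrow> \<not> free_of \<H> G"

definition critically_exist :: "'b pair_pre_digraph set \<Rightarrow> 'a pair_pre_digraph \<Rightarrow> bool" where
  "critically_exist \<H> G \<longleftrightarrow>
    exist_of \<H> G \<and> (\<forall>(u, v)\<in>parcs G. free_of \<H> (contract G u v))"

end

theory Submission
  imports Defs
begin

text \<open>
  Contracting an edge with both ends outside \<open>S\<close> leaves \<open>G[S]\<close> intact. If \<open>N[x] \<subseteq> N[y]\<close> with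
  \<open>x \<notin> S\<close> and \<open>y \<in> S\<close>, then \<open>xy\<close> is an edge, and in \<open>G/xy\<close> the new vertex is adjacent to exactly
  \<open>N(y) - {x}\<close>, so it replaces \<open>y\<close> in a copy of \<open>G[S]\<close>. Either way a contraction of \<open>G\<close> still
  contains a member of \<open>\<H>\<close>.
\<close>

lemma digraph_iso_induce_image:
  assumes wf: "pair_wf_digraph G"
    and inj: "inj_on f S"
    and arcs: "\<And>a b. \<lbrakk>a \<in> S; b \<in> S\<rbrakk> \<Longrightarrow> (f a, f b) \<in> parcs C \<longleftrightarrow> (a, b) \<in> parcs G"
  shows "digraph_iso (with_proj G \<restriction> S) (with_proj C \<restriction> f ` S)"
proof -
  interpret pair_wf_digraph G by fact
  \<comment> \<open>Arcs are vertex pairs, so \<open>f\<close> dictates the arc map, and the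
    projections remain the tail and head in the image.\<close>
  let ?h = "\<lparr> iso_verts = f, iso_arcs = map_prod f f, iso_head = snd, iso_tail = fst \<rparr>"
  have "wf_digraph (with_proj G \<restriction> S)"
    by (rule wellformed_induce_subgraph)
  moreover have "inj_on (map_prod f f) (arcs (with_proj G \<restriction> S))"
    using inj by (auto simp: inj_on_def)
  ultimately have "pre_digraph.digraph_isomorphism (with_proj G \<restriction> S) ?h"
    using inj by (simp add: pre_digraph.digraph_isomorphism_def)
  \<comment> \<open>Reflection of arcs gives the inclusion from right to left: an arc from
    \<open>f a\<close> to \<open>f b\<close> comes from \<open>(a, b)\<close>.\<close>
  moreover have "map_prod f f ` arcs (with_proj G \<restriction> S) = arcs (with_proj C \<restriction> f ` S)"
    using arcs by (fastforce simp: image_iff)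
  then have "with_proj C \<restriction> f ` S = app_iso ?h (with_proj G \<restriction> S)"
    by (simp add: app_iso_def induce_subgraph_def with_proj_def)
  ultimately show ?thesis
    unfolding digraph_iso_def by blast
qed

lemma not_free_of_embedding:
  assumes G: "pair_graph G" and C: "pair_graph C"
    and H: "H \<in> \<H>" "digraph_iso (with_proj G \<restriction> S) (with_proj H)"
    and f: "inj_on f S" "f ` S \<subseteq> pverts C"
    and arcs: "\<And>a b. \<lbrakk>a \<in> S; b \<in> S\<rbrakk> \<Longrightarrow> (f a, f b) \<in> parcs C \<longleftrightarrow> (a, b) \<in> parcs G"
  shows "\<not> free_of \<H> C"
proof -
  interpret G: pair_graph G by fact
  interpret C: pair_graph C by fact
  have "digraph_iso (with_proj G \<restriction> S) (with_proj C \<restriction> f ` S)"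
    using G.pair_wf_digraph_axioms f(1) arcs by (rule digraph_iso_induce_image)
  \<comment> \<open>\<open>free_of\<close> speaks of isomorphisms from the induced subgraph to
    \<open>H\<close>, hence the reversal before composing.\<close>
  then have "digraph_iso (with_proj C \<restriction> f ` S) (with_proj G \<restriction> S)"
    by (rule digraph_iso_swap[OF G.wellformed_induce_subgraph])
  then have "digraph_iso (with_proj C \<restriction> f ` S) (with_proj H)"
    using H(2) by (rule digraph_iso_trans)
  moreover have "induced_subgraph (with_proj C \<restriction> f ` S) (with_proj C)"
    using f(2) by (rule C.induced_induce)
  ultimately show ?thesis
    using H(1) unfolding free_of_def by blast
qed

theorem theorem11:
  fixes G :: "'a pair_pre_digraph" and \<H> :: "'b pair_pre_digraph set"
  assumes "pair_graph G"
    and "\<And>H. H \<in> \<H> \<Longrightarrow> pair_graph H"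
    and "critically_exist \<H> G"
  shows "\<forall>S. S \<subseteq> pverts G \<and> (\<exists>H\<in>\<H>. digraph_iso (with_proj G \<restriction> S) (with_proj H)) \<longrightarrow>
    independent_set G (pverts G - S) \<and>
    \<not> (\<exists>x\<in>pverts G - S. \<exists>y\<in>S. closed_neighbourhood G x \<subseteq> closed_neighbourhood G y)"
proof (intro allI impI conjI)
  interpret pair_graph G by fact
  have crit: "free_of \<H> (contract G x y)" if "(x, y) \<in> parcs G" for x y
    using assms(3) that unfolding critically_exist_def by blast
  fix S assume "S \<subseteq> pverts G \<and> (\<exists>H\<in>\<H>. digraph_iso (with_proj G \<restriction> S) (with_proj H))"
  then obtain H where S: "S \<subseteq> pverts G"
    and H: "H \<in> \<H>" "digraph_iso (with_proj G \<restriction> S) (with_proj H)"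
    by blast
  note not_free = not_free_of_embedding[OF assms(1) pair_graph_contract[OF assms(1)] H]
  have "(x, y) \<notin> parcs G" if "x \<in> pverts G - S" "y \<in> pverts G - S" for x y
  proof
    assume "(x, y) \<in> parcs G"
    \<comment> \<open>Neither \<open>x\<close> nor \<open>y\<close> lies in \<open>S\<close>, so
      every vertex of \<open>S\<close> survives as its \<open>Some\<close> copy, with unchanged
      adjacencies.\<close>
    moreover have "\<not> free_of \<H> (contract G x y)"
      using S that by (intro not_free[where f = Some]) (auto simp: contract_def Let_def)
    ultimately show False
      using crit by blast
  qed
  then show "independent_set G (pverts G - S)"
    unfolding independent_set_def by blast
  show "\<not> (\<exists>x\<in>pverts G - S. \<exists>y\<in>S. closed_neighbourhood G x \<subseteq> closed_neighbourhood G y)"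
  proof
    assume "\<exists>x\<in>pverts G - S. \<exists>y\<in>S. closed_neighbourhood G x \<subseteq> closed_neighbourhood G y"
    then obtain x y where x: "x \<in> pverts G" "x \<notin> S" and y: "y \<in> S"
      and sub: "closed_neighbourhood G x \<subseteq> closed_neighbourhood G y"
      by blast
    \<comment> \<open>\<open>x\<close> lies in its own closed neighbourhood, hence in that of
      \<open>y\<close>, and \<open>x\<close> differs from \<open>y\<close> since only
      \<open>y\<close> is in \<open>S\<close>.\<close>
    have xy: "(x, y) \<in> parcs G"
      using sub x y by (auto simp: closed_neighbourhood_def neighbourhood_def dest: arcs_symmetric)
    have nb: "(neighbourhood G x \<union> neighbourhood G y) - {x, y} = neighbourhood G y - {x}"
      using sub by (auto simp: closed_neighbourhood_def neighbourhood_def dest: no_loops')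
    let ?f = "\<lambda>a. if a = y then None else Some a"
    have "\<not> free_of \<H> (contract G x y)"
    proof (rule not_free)
      show "inj_on ?f S"
        by (auto simp: inj_on_def)
      show "?f ` S \<subseteq> pverts (contract G x y)"
        using S x by (auto simp: contract_def Let_def)
      \<comment> \<open>By \<open>nb\<close>, \<open>None\<close> has the neighbours of
        \<open>y\<close> except \<open>x\<close>, and \<open>x\<close> is not in \<open>S\<close>.
        For \<open>a = b = y\<close> both sides fail, as there are no loops.\<close>
      show "(?f a, ?f b) \<in> parcs (contract G x y) \<longleftrightarrow> (a, b) \<in> parcs G"
        if "a \<in> S" "b \<in> S" for a b
        using that x unfolding contract_def Let_def nb
        by (auto simp: neighbourhood_def dest: arcs_symmetric no_loops')
    qed
    with crit[OF xy] show False
      by blast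
  qed
qed

end
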